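(* Let $\hat{A}\in\mathbb{DC}_n^{\mathrm{CM}}$ with $r=\operatorname{Rank}(\hat A)$ have the form $$\hat{A}=\hat{U}\begin{bmatrix}\Sigma_1K&\Sigma_1L\\0&0\end{bmatrix}\hat{U}^*,$$ where $\hat U\in\mathbb{DC}_n^U$, $K\in\mathbb{DC}^{r\times r}$, $L\in\mathbb{DC}^{r\times(n-r)}$ satisfy $KK^*+LL^*=I_r$, and $\Sigma_1=\operatorname{diag}(\mu_1,\ldots,\mu_r)$ with $\mu_1\ge\cdots\ge\mu_r$ positive appreciable dual numbers. Then the following are equivalent: (a) $\hat{A}^{N}=\hat{A}^{\#}$; (b) $\hat{A}^{N}=\hat{A}^{\mathrm{core}}$; (c) $\hat{A}^{\#}=\hat{A}^{\mathrm{core}}$; (d) $L=0$.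
   Context: Dual complex numbers are $\hat a=a_s+\epsilon a_d$ with $a_s,a_d\in\mathbb{C}$, $\epsilon\ne0$, $\epsilon^2=0$, $\epsilon$ commuting with scalars; they form the ring $\mathbb{DC}$. A dual number is such an element with $a_s,a_d\in\mathbb{R}$. It is appreciable if $a_s\neq0$ and infinitesimal if $a_s=0$. Dual numbers are totally ordered by: $\hat a\le\hat b$ iff $a_s<b_s$, or $a_s=b_s$ and $a_d\le b_d$; $\hat a$ is positive if $\hat a>0$. A matrix $\hat A\in\mathbb{DC}^{m\times n}$ is written $\hat A=A_s+\epsilon A_d$ with $A_s,A_d\in\mathbb{C}^{m\times n}$; $\hat A^*=A_s^*+\epsilon A_d^*$. $\mathbb{DC}_n^U$ is the set of $\hat U\in\mathbb{DC}^{n\times n}$ with $\hat U^{-1}=\hat U^*$. Dual SVD: every $\hat A\in\mathbb{DC}^{n\times n}$ can be written $\hat A=\hat P\begin{bmatrix}\Sigma_1&0\\0&\Sigma_2\end{bmatrix}\hat V^*$ with $\hat P,\hat V\in\mathbb{DC}_n^U$, $\Sigma_1=\operatorname{diag}(\mu_1,\ldots,\mu_{r'})$ with $\mu_1\ge\dots\ge\mu_{r'}$ positive appreciable dual numbers, and $\Sigma_2=\operatorname{diag}(\mu_{r'+1},\ldots,\mu_t,0,\ldots,0)$ with $\mu_{r'+1}\ge\dots\ge\mu_t$ positive infinitesimal dual numbers; the $\mu_i$ are uniquely determined by $\hat A$ and $\operatorname{Rank}(\hat A)=t$. The essential part is $\hat A_e=\hat P\begin{bmatrix}\Sigma_1&0\\0&0\end{bmatrix}\hat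 V^*$. $\mathbb{DC}_n^{\mathrm{CM}}=\{\hat A\in\mathbb{DC}^{n\times n}:\mathcal R(\hat A^2)=\mathcal R(\hat A)\}$, where $\mathcal R(\hat A)=\{\hat Ax:x\in\mathbb{DC}^n\}$. The new dual Moore-Penrose inverse $\hat A^N$ is the unique $\hat X$ with $\hat A\hat X\hat A=\hat A_e$, $\hat X\hat A\hat X=\hat X$, $(\hat A\hat X)^*=\hat A\hat X$, $(\hat X\hat A)^*=\hat X\hat A$. For $\hat A\in\mathbb{DC}_n^{\mathrm{CM}}$: the dual group inverse $\hat A^{\#}$ is the unique $\hat X$ with $\hat A\hat X\hat A=\hat A$, $\hat X\hat A\hat X=\hat X$, $\hat A\hat X=\hat X\hat A$; the dual core generalized inverse $\hat A^{\mathrm{core}}$ is the unique $\hat X$ with $\hat A\hat X\hat A=\hat A$, $\hat A\hat X^2=\hat X$, $(\hat A\hat X)^*=\hat A\hat X$. *)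

theory Defs
  imports Jordan_Normal_Form.Matrix
begin

section \<open>Dual numbers\<close>

text \<open>\<open>Dual a b\<close> is a + \<open>\<epsilon>\<close>b with \<open>\<epsilon>\<close> squared equal to 0.\<close>

datatype 'a dual = Dual (std_part: 'a) (inf_part: 'a)

type_synonym dcomplex = "complex dual"
type_synonym dreal = "real dual"

instantiation dual :: (comm_ring_1) comm_ring_1
begin

definition zero_dual :: "'a dual" where "0 = Dual 0 0"
definition one_dual :: "'a dual" where "1 = Dual 1 0"
definition plus_dual :: "'a dual \<Rightarrow> 'a dual \<Rightarrow> 'a dual" where
  "a + b = Dual (std_part a + std_part b) (inf_part a + inf_part b)"
definition uminus_dual :: "'a dual \<Rightarrow> 'a dual" where
  "- a = Dual (- std_part a) (- inf_part a)"
definition minus_dual :: "'a dual \<Rightarrow> 'a dual \<Rightarrow> 'a dual" where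
  "a - b = Dual (std_part a - std_part b) (inf_part a - inf_part b)"
definition times_dual :: "'a dual \<Rightarrow> 'a dual \<Rightarrow> 'a dual" where
  "a * b = Dual (std_part a * std_part b)
                (std_part a * inf_part b + inf_part a * std_part b)"

instance
  by intro_classes
    (auto simp: zero_dual_def one_dual_def plus_dual_def uminus_dual_def minus_dual_def
      times_dual_def algebra_simps)

end

instantiation dual :: (linorder) linorder
begin

definition less_eq_dual :: "'a dual \<Rightarrow> 'a dual \<Rightarrow> bool" where
  "a \<le> b \<longleftrightarrow> std_part a < std_part b \<or> (std_part a = std_part b \<and> inf_part a \<le> inf_part b)"
definition less_dual :: "'a dual \<Rightarrow> 'a dual \<Rightarrow> bool" where
  "a < b \<longleftrightarrow> a \<le> b \<and> a \<noteq> (b :: 'a dual)"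

instance
  by intro_classes (auto simp: less_eq_dual_def less_dual_def intro: dual.expand)

end

instantiation dual :: (conjugate) conjugate
begin

definition conjugate_dual :: "'a dual \<Rightarrow> 'a dual" where
  "conjugate a = Dual (conjugate (std_part a)) (conjugate (inf_part a))"

instance
  by intro_classes (auto simp: conjugate_dual_def intro: dual.expand)

end

instance dual :: ("{comm_ring_1, conjugatable_ring}") conjugatable_ring
  by intro_classes
    (auto simp: conjugate_dual_def zero_dual_def plus_dual_def uminus_dual_def times_dual_def
      conjugate_dist_add conjugate_dist_mul conjugate_neg)

definition appreciable :: "'a::zero dual \<Rightarrow> bool" where
  "appreciable a \<longleftrightarrow> std_part a \<noteq> 0"

definition infinitesimal :: "'a::zero dual \<Rightarrow> bool" where
  "infinitesimal a \<longleftrightarrow> std_part a = 0"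

abbreviation dcomplex_of_dreal :: "dreal \<Rightarrow> dcomplex" where
  "dcomplex_of_dreal \<equiv> map_dual complex_of_real"


section \<open>Dual complex matrices\<close>

text \<open>The library's \<open>mat_adjoint\<close> is restricted to matrices over fields.\<close>

definition adjoint :: "'a::conjugatable_ring mat \<Rightarrow> 'a mat" where
  "adjoint A = (map_mat conjugate A)\<^sup>T"

definition dc_unitary :: "nat \<Rightarrow> dcomplex mat set" where
  "dc_unitary n = {U \<in> carrier_mat n n. inverts_mat U (adjoint U) \<and> inverts_mat (adjoint U) U}"

definition mat_range :: "'a::semiring_0 mat \<Rightarrow> 'a vec set" where
  "mat_range A = {A *\<^sub>v x |x. x \<in> carrier_vec (dim_col A)}"

definition dc_CM :: "nat \<Rightarrow> dcomplex mat set" where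
  "dc_CM n = {A \<in> carrier_mat n n. mat_range (A * A) = mat_range A}"

text \<open>\<open>dreal_diag m d\<close> is the diagonal matrix with entries \<open>d 0, ..., d (m - 1)\<close>; the
  sequences \<open>\<mu>\<close> below are likewise indexed from 0, and their values beyond the stated range
  are irrelevant.\<close>

definition dreal_diag :: "nat \<Rightarrow> (nat \<Rightarrow> dreal) \<Rightarrow> dcomplex mat" where
  "dreal_diag m d = mat_diag m (\<lambda>i. dcomplex_of_dreal (d i))"

definition block_diag :: "'a::zero mat \<Rightarrow> 'a mat \<Rightarrow> 'a mat" where
  "block_diag A B =
     four_block_mat A (0\<^sub>m (dim_row A) (dim_col B)) (0\<^sub>m (dim_row B) (dim_col A)) B"

definition positive_appreciable_decreasing :: "nat \<Rightarrow> (nat \<Rightarrow> dreal) \<Rightarrow> bool" where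
  "positive_appreciable_decreasing r \<mu> \<longleftrightarrow>
     (\<forall>i<r. 0 < \<mu> i \<and> appreciable (\<mu> i)) \<and> (\<forall>i j. i \<le> j \<longrightarrow> j < r \<longrightarrow> \<mu> j \<le> \<mu> i)"

text \<open>\<open>s\<close> is the number of appreciable singular values and \<open>t\<close> the number of all nonzero
  singular values.\<close>

definition is_dual_SVD ::
  "nat \<Rightarrow> dcomplex mat \<Rightarrow> dcomplex mat \<Rightarrow> dcomplex mat \<Rightarrow> nat \<Rightarrow> nat \<Rightarrow> (nat \<Rightarrow> dreal) \<Rightarrow> bool"
where
  "is_dual_SVD n A P V s t \<mu> \<longleftrightarrow>
     P \<in> dc_unitary n \<and> V \<in> dc_unitary n \<and> s \<le> t \<and> t \<le> n \<and>
     positive_appreciable_decreasing s \<mu> \<and>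
     (\<forall>i. s \<le> i \<longrightarrow> i < t \<longrightarrow> 0 < \<mu> i \<and> infinitesimal (\<mu> i)) \<and>
     (\<forall>i j. s \<le> i \<longrightarrow> i \<le> j \<longrightarrow> j < t \<longrightarrow> \<mu> j \<le> \<mu> i) \<and>
     A = P * block_diag (dreal_diag s \<mu>)
                        (dreal_diag (n - s) (\<lambda>i. if s + i < t then \<mu> (s + i) else 0))
           * adjoint V"

definition dual_rank :: "dcomplex mat \<Rightarrow> nat" where
  "dual_rank A = (THE t. \<exists>P V s \<mu>. is_dual_SVD (dim_row A) A P V s t \<mu>)"

definition essential_part :: "dcomplex mat \<Rightarrow> dcomplex mat" where
  "essential_part A = (THE E. \<exists>P V s t \<mu>. is_dual_SVD (dim_row A) A P V s t \<mu> \<and>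
     E = P * block_diag (dreal_diag s \<mu>) (0\<^sub>m (dim_row A - s) (dim_row A - s)) * adjoint V)"


section \<open>Generalized inverses of square dual complex matrices\<close>

definition new_dual_MP_inverse :: "dcomplex mat \<Rightarrow> dcomplex mat" where
  "new_dual_MP_inverse A = (THE X. X \<in> carrier_mat (dim_row A) (dim_row A) \<and>
     A * X * A = essential_part A \<and> X * A * X = X \<and>
     adjoint (A * X) = A * X \<and> adjoint (X * A) = X * A)"

definition dual_group_inverse :: "dcomplex mat \<Rightarrow> dcomplex mat" where
  "dual_group_inverse A = (THE X. X \<in> carrier_mat (dim_row A) (dim_row A) \<and>
     A * X * A = A \<and> X * A * X = X \<and> A * X = X * A)"

definition dual_core_inverse :: "dcomplex mat \<Rightarrow> dcomplex mat" where
  "dual_core_inverse A = (THE X. X \<in> carrier_mat (dim_row A) (dim_row A) \<and>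
     A * X * A = A \<and> A * (X * X) = X \<and> adjoint (A * X) = A * X)"

end

theory Submission
  imports Defs Jordan_Normal_Form.Determinant
begin

text \<open>With \<open>P = U [I; 0]\<close> and \<open>Q = [K L] U*\<close> we have \<open>A = P S Q\<close>, \<open>P* P = I = Q Q*\<close> and \<open>Q P = K\<close>.
  The range condition makes \<open>K\<close> invertible, and with \<open>T\<close>, \<open>K'\<close> the inverses of \<open>S\<close>, \<open>K\<close> the
  Moore-Penrose, core and group inverses are \<open>Q* T P*\<close>, \<open>P K' T P*\<close> and \<open>P K' T K' Q\<close>.
  Any two of them agree iff \<open>Q = K P*\<close>, that is, iff \<open>L = 0\<close>. Completing the rows of \<open>Q\<close> to a
  unitary matrix gives a dual SVD of \<open>A\<close>; since \<open>A X A = A\<close> is solvable, no dual SVD of \<open>A\<close> has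
  infinitesimal singular values, so \<open>A\<close> is its own essential part.\<close>

subsection \<open>Matrices over commutative rings with conjugation\<close>

text \<open>Dimension equations replace carrier sets so that the simplifier can discharge the
  premises and right-nest every product.\<close>

lemma mult_mat_assoc:
  "dim_col A = dim_row B \<Longrightarrow> dim_col B = dim_row C \<Longrightarrow> A * B * C = A * (B * C)"
  for A B C :: "'a::semiring_0 mat"
  by (rule assoc_mult_mat) auto

lemma mult_mat_cancel_left:
  "A * B = 1\<^sub>m n \<Longrightarrow> dim_col A = dim_row B \<Longrightarrow> dim_col B = dim_row C \<Longrightarrow> dim_row C = n
    \<Longrightarrow> A * (B * C) = C"
  for A B C :: "'a::semiring_1 mat"
  by (metis mult_mat_assoc left_mult_one_mat')

text \<open>\<open>det A\<close> has inverse \<open>det B\<close>, so the scaled adjugate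
  \<open>C\<close> is a left inverse of \<open>A\<close>; a left and a right inverse of the same
  matrix agree.\<close>

lemma mult_left_right_inverse_comm_ring:
  fixes A B :: "'a::comm_ring_1 mat"
  assumes A: "A \<in> carrier_mat n n" and B: "B \<in> carrier_mat n n" and AB: "A * B = 1\<^sub>m n"
  shows "B * A = 1\<^sub>m n"
proof -
  define C where "C = det B \<cdot>\<^sub>m adj_mat A"
  have adj: "adj_mat A \<in> carrier_mat n n" "adj_mat A * A = det A \<cdot>\<^sub>m 1\<^sub>m n"
    using adj_mat[OF A] by auto
  have C: "C \<in> carrier_mat n n"
    using adj by (simp add: C_def)
  have "det A * det B = 1"
    using det_mult[OF A B] AB by simp
  then have CA: "C * A = 1\<^sub>m n"
    using adj A by (auto simp: C_def mult_smult_assoc_mat[of _ n n] mult.commute intro!: eq_matI)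
  have "C = C * (A * B)"
    using C AB by simp
  also have "\<dots> = (C * A) * B"
    using A B C by simp
  finally have "C = B"
    using CA B by simp
  with CA show ?thesis by simp
qed

lemma adjoint_dim [simp]:
  "dim_row (adjoint A) = dim_col A" "dim_col (adjoint A) = dim_row A"
  by (auto simp: adjoint_def)

lemma adjoint_carrier [simp]: "A \<in> carrier_mat m n \<Longrightarrow> adjoint A \<in> carrier_mat n m"
  by auto

lemma adjoint_index:
  "i < dim_col A \<Longrightarrow> j < dim_row A \<Longrightarrow> adjoint A $$ (i, j) = conjugate (A $$ (j, i))"
  by (simp add: adjoint_def)

lemma adjoint_adjoint [simp]: "adjoint (adjoint A) = A"
  by (rule eq_matI) (auto simp: adjoint_index)

lemma adjoint_zero [simp]: "adjoint (0\<^sub>m m n) = 0\<^sub>m n m"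
  by (rule eq_matI) (auto simp: adjoint_index)

lemma conjugate_one [simp]: "conjugate 1 = (1 :: 'a::{comm_ring_1, conjugatable_ring})"
  by (metis conjugate_dist_mul conjugate_id mult.commute mult_1)

lemma adjoint_one [simp]: "adjoint (1\<^sub>m n) = (1\<^sub>m n :: 'a::{comm_ring_1, conjugatable_ring} mat)"
  by (rule eq_matI) (auto simp: adjoint_index)

lemma adjoint_mult:
  fixes A B :: "'a::{comm_ring_1, conjugatable_ring} mat"
  assumes "dim_col A = dim_row B"
  shows "adjoint (A * B) = adjoint B * adjoint A"
  by (rule eq_matI)
    (use assms in \<open>auto simp: adjoint_index scalar_prod_def sum_conjugate conjugate_dist_mul
      mult.commute intro!: sum.cong\<close>)

lemma adjoint_minus:
  fixes A B :: "'a::conjugatable_ring mat"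
  assumes "dim_row A = dim_row B" "dim_col A = dim_col B"
  shows "adjoint (A - B) = adjoint A - adjoint B"
proof -
  have "conjugate (a - b) = conjugate a - conjugate b" for a b :: 'a
    by (metis conjugate_dist_add conjugate_neg diff_conv_add_uminus)
  then show ?thesis
    using assms by (intro eq_matI) (auto simp: adjoint_index)
qed

lemma adjoint_four_block_mat:
  assumes "A \<in> carrier_mat nr1 nc1" "B \<in> carrier_mat nr1 nc2"
    and "C \<in> carrier_mat nr2 nc1" "D \<in> carrier_mat nr2 nc2"
  shows "adjoint (four_block_mat A B C D)
    = four_block_mat (adjoint A) (adjoint C) (adjoint B) (adjoint D)"
  by (rule eq_matI) (use assms in \<open>auto simp: adjoint_index\<close>)

lemma block_diag_mat_diag:
  "block_diag (mat_diag a f) (mat_diag b g)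
    = mat_diag (a + b) (\<lambda>i. if i < a then f i else g (i - a))"
  by (rule eq_matI) (auto simp: block_diag_def mat_diag_def)

subsection \<open>Uniqueness of generalized inverses\<close>

text \<open>Taking adjoints in \<open>A * X = (A * Y) * (A * X)\<close> swaps the Hermitian factors
  and gives \<open>A * X = A * Y\<close>; likewise \<open>X * A = Y * A\<close>. Hence
  \<open>X = X * A * X = Y * A * Y = Y\<close>.\<close>

lemma MP_inverse_unique:
  fixes A X Y :: "'a::{comm_ring_1, conjugatable_ring} mat"
  assumes [simp]: "A \<in> carrier_mat n n" "X \<in> carrier_mat n n" "Y \<in> carrier_mat n n"
    and X: "A * X * A = A" "X * A * X = X" "adjoint (A * X) = A * X" "adjoint (X * A) = X * A"
    and Y: "A * Y * A = A" "Y * A * Y = Y" "adjoint (A * Y) = A * Y" "adjoint (Y * A) = Y * A"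
  shows "X = Y"
proof -
  note as = assoc_mult_mat[of _ n n _ n _ n]
  have "A * X = (A * Y) * (A * X)"
    using Y(1) by (metis as assms(1-3) mult_carrier_mat)
  from arg_cong[OF this, of adjoint] have "A * X = (A * X) * (A * Y)"
    using X(3) Y(3) by (metis adjoint_mult assms(1-3) carrier_matD mult_carrier_mat)
  also have "\<dots> = A * Y"
    using X(1) by (metis as assms(1-3) mult_carrier_mat)
  finally have 1: "A * X = A * Y" .
  have "X * A = (X * A) * (Y * A)"
    using Y(1) by (metis as assms(1-3) mult_carrier_mat)
  from arg_cong[OF this, of adjoint] have "X * A = (Y * A) * (X * A)"
    using X(4) Y(4) by (metis adjoint_mult assms(1-3) carrier_matD mult_carrier_mat)
  also have "\<dots> = Y * A"
    using X(1) by (metis as assms(1-3) mult_carrier_mat)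
  finally have 2: "X * A = Y * A" .
  show ?thesis
    using 1 2 X(2) Y(2) by (metis as assms(1-3))
qed

text \<open>Commutation turns \<open>A * Y * A * X\<close> into \<open>Y * (A * X * A)\<close>,
  which gives \<open>A * X = A * Y\<close>.\<close>

lemma group_inverse_unique:
  fixes A X Y :: "'a::comm_ring_1 mat"
  assumes [simp]: "A \<in> carrier_mat n n" "X \<in> carrier_mat n n" "Y \<in> carrier_mat n n"
    and X: "A * X * A = A" "X * A * X = X" "A * X = X * A"
    and Y: "A * Y * A = A" "Y * A * Y = Y" "A * Y = Y * A"
  shows "X = Y"
proof -
  note as = assoc_mult_mat[of _ n n _ n _ n]
  have "A * X = (A * Y) * (A * X)"
    using Y(1) by (metis as assms(1-3) mult_carrier_mat)
  also have "\<dots> = Y * (A * X * A)"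
    using X(3) Y(3) by (metis as assms(1-3) mult_carrier_mat)
  finally have 1: "A * X = A * Y"
    using X(1) Y(3) by simp
  then show ?thesis
    using X Y by (metis as assms(1-3))
qed

text \<open>\<open>A * X = A * Y\<close> follows as for the Moore-Penrose inverse. The commuting
  inner inverse \<open>G\<close> then cancels \<open>A\<close>: if \<open>A * (Z * Z) = Z\<close>,
  then \<open>G * (A * Z) = Z\<close>.\<close>

lemma core_inverse_unique:
  fixes A X Y G :: "'a::{comm_ring_1, conjugatable_ring} mat"
  assumes [simp]: "A \<in> carrier_mat n n" "X \<in> carrier_mat n n" "Y \<in> carrier_mat n n"
      "G \<in> carrier_mat n n"
    and G: "A * G * A = A" "A * G = G * A"
    and X: "A * X * A = A" "A * (X * X) = X" "adjoint (A * X) = A * X"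
    and Y: "A * Y * A = A" "A * (Y * Y) = Y" "adjoint (A * Y) = A * Y"
  shows "X = Y"
proof -
  note as = assoc_mult_mat[of _ n n _ n _ n]
  have "A * X = (A * Y) * (A * X)"
    using Y(1) by (metis as assms(1-3) mult_carrier_mat)
  from arg_cong[OF this, of adjoint] have "A * X = (A * X) * (A * Y)"
    using X(3) Y(3) by (metis adjoint_mult assms(1-3) carrier_matD mult_carrier_mat)
  also have "\<dots> = A * Y"
    using X(1) by (metis as assms(1-3) mult_carrier_mat)
  finally have 1: "A * X = A * Y" .
  have "G * (A * Z) = Z" if [simp]: "Z \<in> carrier_mat n n" and "A * (Z * Z) = Z" for Z
  proof -
    have "G * (A * Z) = (A * G * A) * (Z * Z)"
      using that G(2) by (metis as assms(1,4) mult_carrier_mat)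
    then show ?thesis using that G(1) by simp
  qed
  then show ?thesis
    using 1 X(2) Y(2) assms(2,3) by metis
qed

subsection \<open>Generalized inverses from a full-rank factorization\<close>

text \<open>Only matrix identities are assumed, so this algebra is valid over every commutative ring
  with conjugation. The product \<open>Q * P\<close> takes the place of \<open>K\<close>.\<close>

locale orthonormal_factorization =
  fixes n r :: nat and P S T Q K' :: "'a::{comm_ring_1, conjugatable_ring} mat"
  assumes P: "P \<in> carrier_mat n r" and S: "S \<in> carrier_mat r r" and T: "T \<in> carrier_mat r r"
    and Q: "Q \<in> carrier_mat r n" and K': "K' \<in> carrier_mat r r"
    and PP: "adjoint P * P = 1\<^sub>m r" and QQ: "Q * adjoint Q = 1\<^sub>m r"
    and ST: "S * T = 1\<^sub>m r" and TS: "T * S = 1\<^sub>m r"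
    and KK': "Q * P * K' = 1\<^sub>m r" and K'K: "K' * (Q * P) = 1\<^sub>m r"
begin

definition "A = P * S * Q"
definition "MP = adjoint Q * T * adjoint P"
definition "Core = P * K' * T * adjoint P"
definition "Group = P * K' * T * K' * Q"

lemma dims [simp]:
  "dim_row P = n" "dim_col P = r" "dim_row S = r" "dim_col S = r" "dim_row T = r" "dim_col T = r"
  "dim_row Q = r" "dim_col Q = n" "dim_row K' = r" "dim_col K' = r"
  using P S T Q K' by auto

lemma KK'_assoc: "Q * (P * K') = 1\<^sub>m r"
  using KK' by (simp add: mult_mat_assoc)

text \<open>\<open>X\<close> is the tail of a right-nested product. Together with
  \<open>norm\<close> this is a rewriting system that verifies the defining equations of the
  inverses by normalisation.\<close>

lemma cancel [simp]:
  assumes "dim_row X = r"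
  shows "adjoint P * (P * X) = X" "Q * (adjoint Q * X) = X" "S * (T * X) = X" "T * (S * X) = X"
    "Q * (P * (K' * X)) = X" "K' * (Q * (P * X)) = X"
  using assms mult_mat_cancel_left[OF PP] mult_mat_cancel_left[OF QQ]
    mult_mat_cancel_left[OF ST] mult_mat_cancel_left[OF TS]
    mult_mat_cancel_left[OF KK'] mult_mat_cancel_left[OF K'K]
  by (simp_all add: mult_mat_assoc)

lemmas defs = A_def MP_def Core_def Group_def
lemmas norm = mult_mat_assoc adjoint_mult PP QQ ST TS KK'_assoc K'K

lemma carriers: "A \<in> carrier_mat n n" "MP \<in> carrier_mat n n" "Core \<in> carrier_mat n n"
  "Group \<in> carrier_mat n n"
  by (auto simp: defs)

lemma MP_props: "A * MP * A = A" "MP * A * MP = MP" "adjoint (A * MP) = A * MP"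
    "adjoint (MP * A) = MP * A"
  by (simp_all add: defs norm)

lemma Group_props: "A * Group * A = A" "Group * A * Group = Group" "A * Group = Group * A"
  by (simp_all add: defs norm)

lemma Core_props: "A * Core * A = A" "A * (Core * Core) = Core" "adjoint (A * Core) = A * Core"
  by (simp_all add: defs norm)

text \<open>For \<open>K = Q * P\<close> the assumption makes \<open>K * adjoint K\<close> equal to
  \<open>Q * adjoint Q\<close>, the identity, so \<open>K'\<close> is \<open>adjoint K\<close>. Then
  \<open>adjoint Q = P * K'\<close> and \<open>K' * Q = adjoint P\<close>, which turn the three
  formulas into one.\<close>

lemma coincide:
  assumes Q_eq: "Q = Q * P * adjoint P"
  shows "MP = Core" "Group = Core"
proof -
  have "Q * adjoint Q = Q * P * adjoint (Q * P)"
    by (subst Q_eq) (simp add: norm)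
  then have "Q * P * adjoint (Q * P) = 1\<^sub>m r"
    using QQ by simp
  then have "K' = K' * (Q * P * adjoint (Q * P))"
    by (simp add: norm)
  also have "\<dots> = adjoint P * adjoint Q"
    by (simp add: norm)
  finally have K'_eq: "K' = adjoint P * adjoint Q" .
  have "adjoint Q = adjoint (Q * P * adjoint P)"
    using Q_eq by simp
  then have "adjoint Q = P * K'"
    by (simp add: norm K'_eq)
  then show "MP = Core"
    by (simp add: MP_def Core_def)
  have "K' * Q = K' * (Q * P * adjoint P)"
    using Q_eq by simp
  also have "\<dots> = adjoint P"
    by (simp add: norm)
  finally show "Group = Core"
    by (simp add: Core_def Group_def norm)
qed

lemma range_imp_Q_eq:
  assumes "P * adjoint P * adjoint Q = adjoint Q"
  shows "Q = Q * P * adjoint P"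
  using arg_cong[OF assms, of adjoint] by (simp add: norm)

text \<open>\<open>MP * (P * S)\<close> is \<open>adjoint Q\<close>, so if the projector
  \<open>P * adjoint P\<close> fixes \<open>MP\<close>, it fixes \<open>adjoint Q\<close>.
  \<open>Group\<close> and \<open>Core\<close> begin with \<open>P\<close> and are fixed by it, so
  equality of \<open>MP\<close> with either one suffices.\<close>

lemma MP_range:
  assumes "P * adjoint P * MP = MP"
  shows "Q = Q * P * adjoint P"
proof (rule range_imp_Q_eq)
  have "P * adjoint P * MP * (P * S) = MP * (P * S)"
    using assms by simp
  then show "P * adjoint P * adjoint Q = adjoint Q"
    by (simp add: MP_def norm)
qed

lemma MP_eq_Group_iff: "MP = Group \<longleftrightarrow> Q = Q * P * adjoint P"
proof
  assume "MP = Group"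
  moreover have "P * adjoint P * Group = Group"
    by (simp add: defs norm)
  ultimately show "Q = Q * P * adjoint P"
    using MP_range by simp
qed (use coincide in metis)

lemma MP_eq_Core_iff: "MP = Core \<longleftrightarrow> Q = Q * P * adjoint P"
proof
  assume "MP = Core"
  moreover have "P * adjoint P * Core = Core"
    by (simp add: defs norm)
  ultimately show "Q = Q * P * adjoint P"
    using MP_range by simp
qed (use coincide in metis)

lemma Group_eq_Core_iff: "Group = Core \<longleftrightarrow> Q = Q * P * adjoint P"
proof
  assume "Group = Core"
  \<comment> \<open>This left multiplication reduces \<open>Group\<close> to \<open>Q\<close> and
    \<open>Core\<close> to \<open>Q * P * adjoint P\<close>.\<close>
  then have "Q * P * (S * (Q * Group)) = Q * P * (S * (Q * Core))"
    by simp
  then show "Q = Q * P * adjoint P"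
    by (simp add: Group_def Core_def norm)
qed (use coincide in metis)

end

subsection \<open>Dual complex matrices\<close>

lemma dual_simps:
  "std_part (a + b) = std_part a + std_part b" "inf_part (a + b) = inf_part a + inf_part b"
  "std_part (a * b) = std_part a * std_part b"
  "inf_part (a * b) = std_part a * inf_part b + inf_part a * std_part b"
  "std_part 0 = 0" "inf_part 0 = 0" "std_part 1 = 1" "inf_part 1 = 0"
  for a b :: "'a::comm_ring_1 dual"
  by (auto simp: plus_dual_def times_dual_def zero_dual_def one_dual_def)

lemma std_part_conjugate: "std_part (conjugate a) = conjugate (std_part a)"
  by (simp add: conjugate_dual_def)

lemma std_part_sum: "std_part (sum f X) = (\<Sum>x\<in>X. std_part (f x))"
  by (induction X rule: infinite_finite_induct) (auto simp: dual_simps)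

lemma inf_part_sum: "inf_part (sum f X) = (\<Sum>x\<in>X. inf_part (f x))"
  by (induction X rule: infinite_finite_induct) (auto simp: dual_simps)

lemma infinitesimal_mult: "infinitesimal a \<Longrightarrow> infinitesimal b \<Longrightarrow> a * b = 0"
  for a b :: "'a::comm_ring_1 dual"
  by (auto simp: infinitesimal_def times_dual_def zero_dual_def)

section \<open>Completing orthonormal rows to a unitary matrix\<close>

text \<open>Padding \<open>N\<close> with zero rows gives a singular square matrix; a nonzero kernel
  vector of it is scaled to norm one.\<close>

lemma exists_unit_kernel_column:
  fixes N :: "complex mat"
  assumes N: "N \<in> carrier_mat k n" and "k < n"
  shows "\<exists>x\<in>carrier_vec n. N *\<^sub>v x = 0\<^sub>v k \<and> (\<Sum>i<n. cnj (x $ i) * x $ i) = 1"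
proof -
  \<comment> \<open>The zero row \<open>k\<close> is split off to match the form of
    \<open>det_row_0\<close>.\<close>
  define M where "M = mat\<^sub>r n n (\<lambda>i. if i = k then 0\<^sub>v n else if i < k then row N i else 0\<^sub>v n)"
  have M: "M \<in> carrier_mat n n"
    by (simp add: M_def)
  have "det M = 0"
    unfolding M_def by (rule det_row_0) (use assms in auto)
  then obtain v where v: "v \<in> carrier_vec n" "v \<noteq> 0\<^sub>v n" "M *\<^sub>v v = 0\<^sub>v n"
    using det_0_iff_vec_prod_zero_field[OF M] by blast
  have Nv: "N *\<^sub>v v = 0\<^sub>v k"
  proof (rule eq_vecI)
    fix i assume i: "i < dim_vec (0\<^sub>v k :: complex vec)"
    then have "(M *\<^sub>v v) $ i = 0"
      using v \<open>k < n\<close> by simp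
    then show "(N *\<^sub>v v) $ i = 0\<^sub>v k $ i"
      using i N \<open>k < n\<close> by (simp add: M_def)
  qed (use N in auto)
  define s where "s = (\<Sum>i<n. (cmod (v $ i))\<^sup>2)"
  obtain i where "i < n" "v $ i \<noteq> 0"
    using v by (metis eq_vecI carrier_vecD index_zero_vec)
  then have "s > 0"
    unfolding s_def by (intro sum_pos2[of _ i]) auto
  define c where "c = complex_of_real (1 / sqrt s)"
  have s: "(\<Sum>i<n. cnj (v $ i) * v $ i) = of_real s"
    unfolding s_def of_real_sum complex_norm_square by (simp add: mult.commute)
  have "(\<Sum>i<n. cnj ((c \<cdot>\<^sub>v v) $ i) * (c \<cdot>\<^sub>v v) $ i) = cnj c * c * (\<Sum>i<n. cnj (v $ i) * v $ i)"
    using v by (auto simp: sum_distrib_left intro!: sum.cong)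
  also have "\<dots> = complex_of_real (1 / sqrt s * (1 / sqrt s) * s)"
    unfolding s by (simp only: c_def complex_cnj_complex_of_real of_real_mult)
  also have "1 / sqrt s * (1 / sqrt s) * s = 1"
    using \<open>s > 0\<close> by (simp flip: power2_eq_square add: power_divide)
  finally have "(\<Sum>i<n. cnj ((c \<cdot>\<^sub>v v) $ i) * (c \<cdot>\<^sub>v v) $ i) = 1"
    by simp
  moreover have "N *\<^sub>v (c \<cdot>\<^sub>v v) = 0\<^sub>v k"
    using v Nv by (auto simp: mult_mat_vec[OF N] intro: eq_vecI)
  ultimately show ?thesis
    using v by (intro bexI[of _ "c \<cdot>\<^sub>v v"]) auto
qed

text \<open>A unit kernel vector \<open>x\<close> of the standard part has infinitesimal \<open>Q * x\<close>, so projecting it onto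
  the kernel of \<open>Q\<close> changes its squared norm by a product of two infinitesimals, which is zero.\<close>

lemma exists_orthonormal_column:
  fixes Q :: "dcomplex mat"
  assumes Q: "Q \<in> carrier_mat k n" and QQ: "Q * adjoint Q = 1\<^sub>m k" and "k < n"
  shows "\<exists>y\<in>carrier_mat n 1. Q * y = 0\<^sub>m k 1 \<and> adjoint y * y = 1\<^sub>m 1"
proof -
  obtain v where v: "v \<in> carrier_vec n" "map_mat std_part Q *\<^sub>v v = 0\<^sub>v k"
      "(\<Sum>i<n. cnj (v $ i) * v $ i) = 1"
    using exists_unit_kernel_column[of "map_mat std_part Q" k n] Q \<open>k < n\<close> by auto
  define x where "x = mat n 1 (\<lambda>(i, j). Dual (v $ i) 0)"
  define y where "y = x - adjoint Q * (Q * x)"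
  have [simp]: "x \<in> carrier_mat n 1" "dim_row x = n" "dim_col x = 1"
      "dim_row Q = k" "dim_col Q = n"
    using Q by (auto simp: x_def)
  have xx: "adjoint x * x = 1\<^sub>m 1"
    by (rule eq_matI)
      (use v in \<open>auto simp: scalar_prod_def adjoint_index std_part_sum inf_part_sum dual_simps
        std_part_conjugate conjugate_dual_def x_def atLeast0LessThan intro!: dual.expand\<close>)
  have inf: "infinitesimal ((Q * x) $$ (i, 0))" if "i < k" for i
  proof -
    have "std_part ((Q * x) $$ (i, 0)) = (map_mat std_part Q *\<^sub>v v) $ i"
      using that v(1) by (simp add: x_def scalar_prod_def std_part_sum dual_simps)
    then show ?thesis
      using v that by (simp add: infinitesimal_def)
  qed
  have Qx: "adjoint (Q * x) * (Q * x) = 0\<^sub>m 1 1"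
    by (rule eq_matI)
      (use inf in \<open>auto simp del: index_mult_mat(1)
        simp add: index_mult_mat(1)[of _ "adjoint _"] scalar_prod_def adjoint_index infinitesimal_def
        std_part_conjugate intro!: sum.neutral infinitesimal_mult\<close>)
  have Qy: "Q * y = 0\<^sub>m k 1"
    unfolding y_def
    by (subst mult_minus_distrib_mat[OF Q, of _ 1]) (auto simp: mult_mat_cancel_left[OF QQ])
  \<comment> \<open>\<open>Q * y = 0\<close> removes the correction term from the right factor.
    Removing it from the left factor costs \<open>adjoint (Q * x) * (Q * x)\<close>, which vanishes
    by \<open>Qx\<close>.\<close>
  have "adjoint y * y = adjoint y * x - adjoint y * (adjoint Q * (Q * x))"
    by (subst (2) y_def, subst mult_minus_distrib_mat[of _ 1 n _ 1]) (auto simp: y_def)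
  also have "adjoint y * (adjoint Q * (Q * x)) = adjoint (Q * y) * (Q * x)"
    by (simp add: adjoint_mult y_def mult_mat_assoc)
  also have "\<dots> = 0\<^sub>m 1 1"
    by (simp add: Qy)
  also have "adjoint y * x - 0\<^sub>m 1 1 = adjoint y * x"
    by (rule eq_matI) (auto simp: y_def)
  also have "\<dots> = adjoint x * x - adjoint (adjoint Q * (Q * x)) * x"
    by (subst y_def, subst adjoint_minus, (simp)+, subst minus_mult_distrib_mat[of _ 1 n _ _ 1]) auto
  also have "adjoint (adjoint Q * (Q * x)) * x = adjoint (Q * x) * (Q * x)"
    by (simp add: adjoint_mult mult_mat_assoc)
  finally have "adjoint y * y = 1\<^sub>m 1 - 0\<^sub>m 1 1"
    by (simp add: xx Qx)
  also have "\<dots> = 1\<^sub>m 1"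
    by (rule eq_matI) auto
  finally have "adjoint y * y = 1\<^sub>m 1" .
  with Qy show ?thesis
    by (intro bexI[of _ y]) (auto simp: y_def)
qed

lemma extend_orthonormal_rows:
  fixes Q :: "dcomplex mat"
  assumes Q: "Q \<in> carrier_mat k n" and QQ: "Q * adjoint Q = 1\<^sub>m k" and "k < n"
  shows "\<exists>R\<in>carrier_mat (Suc k) n. R * adjoint R = 1\<^sub>m (Suc k) \<and> (\<forall>i<k. row R i = row Q i)"
proof -
  obtain y where y: "y \<in> carrier_mat n 1" "Q * y = 0\<^sub>m k 1" "adjoint y * y = 1\<^sub>m 1"
    using exists_orthonormal_column[OF assms] by blast
  \<comment> \<open>Blocks of width zero turn \<open>four_block_mat\<close> into a vertical stack,
    with \<open>adjoint y\<close> as the new last row.\<close>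
  define R where "R = four_block_mat Q (0\<^sub>m k 0) (adjoint y) (0\<^sub>m 1 0)"
  have "adjoint y * adjoint Q = 0\<^sub>m 1 k"
    using y Q by (subst adjoint_mult[symmetric]) auto
  then have "R * adjoint R = four_block_mat (1\<^sub>m k) (0\<^sub>m k 1) (0\<^sub>m 1 k) (1\<^sub>m 1)"
    unfolding R_def using Q y QQ
    by (subst adjoint_four_block_mat[of _ k n _ 0 _ 1], (auto)[4],
        subst mult_four_block_mat[of _ k n _ 0 _ 1 _ _ k _ 1]) auto
  then have "R * adjoint R = 1\<^sub>m (Suc k)"
    by simp
  moreover have "R \<in> carrier_mat (Suc k) n"
    using Q y by (auto simp: R_def)
  moreover have "row R i = row Q i" if "i < k" for i
    by (rule eq_vecI) (use Q y that in \<open>auto simp: R_def\<close>)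
  ultimately show ?thesis by blast
qed

text \<open>Rows are appended one at a time. The induction runs downwards from \<open>n\<close>,
  where the matrix is already square, and agreement with the first \<open>k\<close> rows is passed
  along.\<close>

lemma complete_orthonormal_rows:
  fixes Q :: "dcomplex mat"
  assumes "Q \<in> carrier_mat k n" "Q * adjoint Q = 1\<^sub>m k" "k \<le> n"
  shows "\<exists>R\<in>carrier_mat n n. R * adjoint R = 1\<^sub>m n \<and> (\<forall>i<k. row R i = row Q i)"
  using assms(3,1,2)
proof (induction arbitrary: Q rule: inc_induct)
  case base
  then show ?case by auto
next
  case (step m)
  obtain R where R: "R \<in> carrier_mat (Suc m) n" "R * adjoint R = 1\<^sub>m (Suc m)"
      "\<forall>i<m. row R i = row Q i"
    using extend_orthonormal_rows[OF step.prems step.hyps(2)] by blast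
  obtain W where "W \<in> carrier_mat n n" "W * adjoint W = 1\<^sub>m n" "\<forall>i<Suc m. row W i = row R i"
    using step.IH[OF R(1,2)] by blast
  with R(3) show ?case
    by (intro bexI[of _ W]) auto
qed

section \<open>Real dual diagonals, dual SVDs and the essential part\<close>

lemma dreal_diag_carrier [simp]: "dreal_diag m d \<in> carrier_mat m m"
  by (simp add: dreal_diag_def)

lemma dreal_diag_zero: "(\<And>i. i < m \<Longrightarrow> d i = 0) \<Longrightarrow> dreal_diag m d = 0\<^sub>m m m"
  by (rule eq_matI) (auto simp: dreal_diag_def mat_diag_def zero_dual_def)

lemma dreal_diag_inverse:
  assumes "\<And>i. i < m \<Longrightarrow> appreciable (d i)"
  shows "\<exists>T\<in>carrier_mat m m. dreal_diag m d * T = 1\<^sub>m m \<and> T * dreal_diag m d = 1\<^sub>m m"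
proof -
  \<comment> \<open>The inverse of \<open>a + eps b\<close> is
    \<open>1 / a - eps b / a^2\<close>.\<close>
  define e where "e i = Dual (1 / complex_of_real (std_part (d i)))
    (- complex_of_real (inf_part (d i)) / complex_of_real (std_part (d i)) ^ 2)" for i
  have e: "dcomplex_of_dreal (d i) * e i = 1" if "i < m" for i
    using assms[OF that]
    by (auto intro!: dual.expand simp: dual_simps e_def dual.map_sel appreciable_def field_simps
      power2_eq_square)
  have "dreal_diag m d * mat_diag m e = mat_diag m (\<lambda>i. dcomplex_of_dreal (d i) * e i)"
    by (simp add: dreal_diag_def)
  also have "\<dots> = 1\<^sub>m m"
    by (rule eq_matI) (auto simp: mat_diag_def e)
  finally show ?thesis
    by (intro bexI[of _ "mat_diag m e"]) (auto intro: mult_left_right_inverse_comm_ring)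
qed

text \<open>Squares of infinitesimals vanish, so a von Neumann regular matrix has no infinitesimal
  singular values.\<close>

lemma is_dual_SVD_regular:
  assumes svd: "is_dual_SVD n A P V s t \<mu>" and X: "X \<in> carrier_mat n n" and AXA: "A * X * A = A"
  shows "A = P * block_diag (dreal_diag s \<mu>) (0\<^sub>m (n - s) (n - s)) * adjoint V"
proof -
  \<comment> \<open>The diagonals of both blocks are merged into one sequence, which is zero from
    index \<open>t\<close> on.\<close>
  define d where "d i = (if i < s then dcomplex_of_dreal (\<mu> i)
    else dcomplex_of_dreal (if i < t then \<mu> i else 0))" for i
  define D where "D = mat_diag n d"
  have sn: "s \<le> n" and [simp]: "P \<in> carrier_mat n n" "V \<in> carrier_mat n n"
    and inv: "adjoint P * P = 1\<^sub>m n" "adjoint V * V = 1\<^sub>m n"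
    using svd by (auto simp: is_dual_SVD_def dc_unitary_def inverts_mat_def)
  have dims [simp]: "dim_row P = n" "dim_col P = n" "dim_row V = n" "dim_col V = n"
      "dim_row X = n" "dim_col X = n" "dim_row D = n" "dim_col D = n"
    using X carrier_matD[OF \<open>P \<in> carrier_mat n n\<close>] carrier_matD[OF \<open>V \<in> carrier_mat n n\<close>]
    by (auto simp: D_def mat_diag_def)
  have "block_diag (dreal_diag s \<mu>) (dreal_diag (n - s) (\<lambda>i. if s + i < t then \<mu> (s + i) else 0)) = D"
    unfolding dreal_diag_def block_diag_mat_diag
    by (rule eq_matI) (use sn in \<open>auto simp: D_def d_def mat_diag_def\<close>)
  then have A: "A = P * D * adjoint V"
    using svd by (simp add: is_dual_SVD_def)
  \<comment> \<open>\<open>Y\<close> is \<open>X\<close> in the singular bases, where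
    \<open>A * X * A = A\<close> becomes \<open>D * Y * D = D\<close>. Comparing diagonal entries is
    enough.\<close>
  define Y where "Y = adjoint V * X * P"
  have "adjoint P * A * V = D"
    by (simp add: A mult_mat_assoc mult_mat_cancel_left[OF inv(1)] inv)
  moreover have "adjoint P * (A * X * A) * V = D * Y * D"
    by (simp add: A Y_def mult_mat_assoc mult_mat_cancel_left[OF inv(1)] inv)
  ultimately have "D * Y * D = D"
    by (simp add: AXA)
  moreover have "Y \<in> carrier_mat n n"
    by (auto simp: Y_def)
  moreover from this have "(D * Y * D) $$ (i, i) = d i * Y $$ (i, i) * d i" if "i < n" for i
    using that
    by (simp add: D_def mat_diag_mult_left[of _ n n] mat_diag_mult_right[of _ n n]
      del: index_mult_mat(1))
  ultimately have dYd: "d i * Y $$ (i, i) * d i = d i" if "i < n" for i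
    using that by (simp add: D_def mat_diag_def)
  have "d i = 0" if "s \<le> i" "i < n" for i
  proof -
    have "infinitesimal (d i)"
      using svd that by (auto simp: is_dual_SVD_def d_def infinitesimal_def dual.map_sel dual_simps)
    then have "d i * d i * Y $$ (i, i) = 0"
      by (simp add: infinitesimal_mult)
    then show ?thesis
      using dYd[OF that(2)] by (simp add: ac_simps)
  qed
  then have "D = block_diag (dreal_diag s \<mu>) (mat_diag (n - s) (\<lambda>_. 0))"
    unfolding dreal_diag_def block_diag_mat_diag
    by (intro eq_matI) (use sn in \<open>auto simp: D_def d_def mat_diag_def\<close>)
  moreover have "mat_diag (n - s) (\<lambda>_. 0) = (0\<^sub>m (n - s) (n - s) :: dcomplex mat)"
    by (rule eq_matI) (auto simp: mat_diag_def)
  ultimately show ?thesis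
    using A by simp
qed

text \<open>Every dual SVD of such an \<open>A\<close> yields \<open>E = A\<close>, so the definite
  description is determined here without a general uniqueness result; the given SVD supplies
  existence.\<close>

lemma essential_part_regular:
  assumes A: "A \<in> carrier_mat n n" and svd: "is_dual_SVD n A P V s t \<mu>"
    and X: "X \<in> carrier_mat n n" and AXA: "A * X * A = A"
  shows "essential_part A = A"
  unfolding essential_part_def
proof (rule the_equality)
  have [simp]: "dim_row A = n" using A by auto
  show "\<exists>P V s t \<mu>. is_dual_SVD (dim_row A) A P V s t \<mu> \<and>
     A = P * block_diag (dreal_diag s \<mu>) (0\<^sub>m (dim_row A - s) (dim_row A - s)) * adjoint V"
    unfolding \<open>dim_row A = n\<close> using svd is_dual_SVD_regular[OF svd X AXA] by blast
  show "E = A" if "\<exists>P V s t \<mu>. is_dual_SVD (dim_row A) A P V s t \<mu> \<and>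
     E = P * block_diag (dreal_diag s \<mu>) (0\<^sub>m (dim_row A - s) (dim_row A - s)) * adjoint V" for E
    using that is_dual_SVD_regular[OF _ X AXA] by auto
qed

text \<open>\<open>V\<close> is the adjoint of a unitary completion \<open>R\<close> of
  \<open>Q\<close>. The zero block annihilates the added rows \<open>M\<close>, so the diagonal
  factor times \<open>R\<close> equals \<open>J * (S * Q)\<close>.\<close>

lemma exists_dual_SVD:
  assumes U: "U \<in> dc_unitary n" and Q: "Q \<in> carrier_mat r n" and QQ: "Q * adjoint Q = 1\<^sub>m r"
    and "r \<le> n" and \<mu>: "positive_appreciable_decreasing r \<mu>"
  shows "\<exists>V. is_dual_SVD n
    (U * four_block_mat (1\<^sub>m r) (0\<^sub>m r 0) (0\<^sub>m (n - r) r) (0\<^sub>m (n - r) 0) * dreal_diag r \<mu> * Q) U V r r \<mu>"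
proof -
  obtain R where R: "R \<in> carrier_mat n n" "R * adjoint R = 1\<^sub>m n" "\<forall>i<r. row R i = row Q i"
    using complete_orthonormal_rows[OF Q QQ \<open>r \<le> n\<close>] by blast
  have V: "adjoint R \<in> dc_unitary n"
    using R mult_left_right_inverse_comm_ring[OF R(1) _ R(2)]
    by (auto simp: dc_unitary_def inverts_mat_def)
  define J :: "dcomplex mat" where
    "J = four_block_mat (1\<^sub>m r) (0\<^sub>m r 0) (0\<^sub>m (n - r) r) (0\<^sub>m (n - r) 0)"
  define S where "S = dreal_diag r \<mu>"
  define M where "M = mat (n - r) n (\<lambda>(i, j). R $$ (i + r, j))"
  have [simp]: "S \<in> carrier_mat r r" "M \<in> carrier_mat (n - r) n" "J \<in> carrier_mat n r"
      "U \<in> carrier_mat n n" "Q \<in> carrier_mat r n"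
      "dim_row S = r" "dim_col S = r" "dim_row J = n" "dim_col J = r" "dim_row U = n" "dim_col U = n"
      "dim_row Q = r" "dim_col Q = n"
    using \<open>r \<le> n\<close> U Q by (auto simp: S_def M_def J_def dc_unitary_def dreal_diag_def mat_diag_def)
  have "R $$ (i, j) = Q $$ (i, j)" if "i < r" "j < n" for i j
    using R(1,3) Q that \<open>r \<le> n\<close> by (metis carrier_matD index_row(1) order_less_le_trans)
  then have "R = four_block_mat Q (0\<^sub>m r 0) M (0\<^sub>m (n - r) 0)"
    by (intro eq_matI) (use R(1) \<open>r \<le> n\<close> in \<open>auto simp: M_def\<close>)
  moreover have "S * Q \<in> carrier_mat r n"
    by auto
  ultimately have "block_diag S (0\<^sub>m (n - r) (n - r)) * R
      = four_block_mat (S * Q) (0\<^sub>m r 0) (0\<^sub>m (n - r) n) (0\<^sub>m (n - r) 0)"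
    by (simp add: block_diag_def mult_four_block_mat[of _ r r _ "n - r" _ "n - r" _ _ n _ 0]
      left_add_zero_mat[of _ "n - r" n] left_mult_zero_mat[of _ "n - r" n] right_add_zero_mat[of _ r n])
  also have "\<dots> = J * four_block_mat (S * Q) (0\<^sub>m r 0) (0\<^sub>m 0 n) (0\<^sub>m 0 0)"
    unfolding J_def by (subst mult_four_block_mat[of _ r r _ 0 _ "n - r" _ _ n _ 0]) auto
  also have "four_block_mat (S * Q) (0\<^sub>m r 0) (0\<^sub>m 0 n) (0\<^sub>m 0 0) = S * Q"
    by (rule eq_matI) auto
  finally have eq: "block_diag S (0\<^sub>m (n - r) (n - r)) * R = J * (S * Q)" .
  have "U * J * S * Q = U * (block_diag S (0\<^sub>m (n - r) (n - r)) * R)"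
    unfolding eq by (simp add: mult_mat_assoc)
  also have "\<dots> = U * block_diag S (0\<^sub>m (n - r) (n - r)) * R"
    using R(1) \<open>r \<le> n\<close> by (simp add: mult_mat_assoc block_diag_def)
  \<comment> \<open>With \<open>s = t = r\<close> there are no infinitesimal singular values, and
    the condition \<open>r + i < r\<close> always fails.\<close>
  also have "(0\<^sub>m (n - r) (n - r) :: dcomplex mat)
      = dreal_diag (n - r) (\<lambda>i. if r + i < r then \<mu> (r + i) else 0)"
    by (simp add: dreal_diag_zero)
  finally have "is_dual_SVD n (U * J * S * Q) U (adjoint R) r r \<mu>"
    using U V \<open>r \<le> n\<close> \<mu> by (simp add: is_dual_SVD_def S_def)
  then show ?thesis
    by (auto simp: J_def S_def)
qed

section \<open>The range condition and the equivalence of the four conditions\<close>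

text \<open>Each column of \<open>A\<close> lies in the range of \<open>A\<close>, hence in that of
  \<open>A * A\<close>; the solutions \<open>y j\<close> become the columns of
  \<open>Y\<close>.\<close>

lemma dc_CM_factor:
  assumes "A \<in> dc_CM n"
  shows "\<exists>Y\<in>carrier_mat n n. A * A * Y = A"
proof -
  have A: "A \<in> carrier_mat n n" and rng: "mat_range (A * A) = mat_range A"
    using assms by (auto simp: dc_CM_def)
  have "\<exists>y\<in>carrier_vec n. (A * A) *\<^sub>v y = col A j" if "j < n" for j
  proof -
    have "col A j = A *\<^sub>v unit_vec n j"
      by (rule eq_vecI) (use A that in \<open>auto simp: scalar_prod_right_unit\<close>)
    then have "col A j \<in> mat_range A"
      using A by (auto simp: mat_range_def)
    then show ?thesis
      using A unfolding rng[symmetric] by (auto simp: mat_range_def)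
  qed
  then obtain y where y: "\<And>j. j < n \<Longrightarrow> y j \<in> carrier_vec n \<and> (A * A) *\<^sub>v y j = col A j"
    by metis
  define Y where "Y = mat n n (\<lambda>(i, j). y j $ i)"
  have "A * A * Y = A"
  proof (rule eq_matI)
    fix i j assume ij: "i < dim_row A" "j < dim_col A"
    then have j: "j < n" "i < n" using A by auto
    have "col Y j = y j"
      using y[OF j(1)] j by (auto simp: Y_def)
    then have "(A * A * Y) $$ (i, j) = ((A * A) *\<^sub>v y j) $ i"
      using A j by (simp add: Y_def)
    then show "(A * A * Y) $$ (i, j) = A $$ (i, j)"
      using y[OF j(1)] A j by simp
  qed (use A in \<open>auto simp: Y_def\<close>)
  then show ?thesis
    by (intro bexI[of _ Y]) (auto simp: Y_def)
qed

theorem theorem4p13: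
  fixes n r :: nat
    and A U K L S :: "dcomplex mat"
    and \<mu> :: "nat \<Rightarrow> dreal"
  assumes A: "A \<in> dc_CM n"
    and r: "r = dual_rank A" "r \<le> n"
    and U: "U \<in> dc_unitary n"
    and K: "K \<in> carrier_mat r r"
    and L: "L \<in> carrier_mat r (n - r)"
    and KL: "K * adjoint K + L * adjoint L = 1\<^sub>m r"
    and \<mu>: "positive_appreciable_decreasing r \<mu>"
    and S: "S = dreal_diag r \<mu>"
    and form: "A = U * four_block_mat (S * K) (S * L)
                         (0\<^sub>m (n - r) r) (0\<^sub>m (n - r) (n - r)) * adjoint U"
  shows "(new_dual_MP_inverse A = dual_group_inverse A
            \<longleftrightarrow> new_dual_MP_inverse A = dual_core_inverse A)
       \<and> (new_dual_MP_inverse A = dual_core_inverse A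
            \<longleftrightarrow> dual_group_inverse A = dual_core_inverse A)
       \<and> (dual_group_inverse A = dual_core_inverse A
            \<longleftrightarrow> L = 0\<^sub>m r (n - r))"
proof -
  \<comment> \<open>\<open>J\<close> is \<open>[I; 0]\<close> and \<open>W\<close> is
    \<open>[K L]\<close>, written with empty blocks so that \<open>mult_four_block_mat\<close>
    applies.\<close>
  define J :: "dcomplex mat" where
    "J = four_block_mat (1\<^sub>m r) (0\<^sub>m r 0) (0\<^sub>m (n - r) r) (0\<^sub>m (n - r) 0)"
  define W where "W = four_block_mat K L (0\<^sub>m 0 r) (0\<^sub>m 0 (n - r))"
  define P where "P = U * J"
  define Q where "Q = W * adjoint U"
  have UU: "adjoint U * U = 1\<^sub>m n"
    using U by (simp add: dc_unitary_def inverts_mat_def) (metis adjoint_dim(1) carrier_matD(2))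
  have S_carrier: "S \<in> carrier_mat r r"
    by (simp add: S)
  have W_carrier: "W \<in> carrier_mat r n" and J_carrier: "J \<in> carrier_mat n r"
    and U_carrier: "U \<in> carrier_mat n n"
    using K L U \<open>r \<le> n\<close> by (auto simp: W_def J_def dc_unitary_def)
  then have [simp]: "dim_row W = r" "dim_col W = n" "dim_row J = n" "dim_col J = r"
      "dim_row U = n" "dim_col U = n" "dim_row S = r" "dim_col S = r" "dim_row K = r" "dim_col K = r"
      "dim_row L = r" "dim_col L = n - r"
    using S_carrier K L by auto
  have pad: "four_block_mat M (0\<^sub>m r 0) (0\<^sub>m 0 r) (0\<^sub>m 0 0) = M"
    if "M \<in> carrier_mat r r" for M :: "dcomplex mat"
    by (rule eq_matI) (use that in auto)
  have JJ: "adjoint J * J = 1\<^sub>m r"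
    unfolding J_def
    by (subst adjoint_four_block_mat[of _ r r _ 0 _ "n - r"], (auto)[4],
        subst mult_four_block_mat[of _ r r _ "n - r" _ 0 _ _ r _ 0]) (auto simp: pad)
  have WW: "W * adjoint W = 1\<^sub>m r"
    unfolding W_def using K L KL
    by (subst adjoint_four_block_mat[of _ r r _ "n - r" _ 0], (auto)[4],
        subst mult_four_block_mat[of _ r r _ "n - r" _ 0 _ _ r _ 0]) (auto simp: pad)
  have WJ: "W * J = K"
    unfolding W_def J_def using K L
    by (subst mult_four_block_mat[of _ r r _ "n - r" _ 0 _ _ r _ 0]) (auto simp: pad)
  have "S * W = four_block_mat (S * K) (S * L) (0\<^sub>m 0 r) (0\<^sub>m 0 (n - r))"
    unfolding W_def using K L S_carrier
    by (subst pad[symmetric, of S], simp,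
        subst mult_four_block_mat[of _ r r _ 0 _ 0 _ _ r _ "n - r"]) auto
  then have "J * (S * W) = four_block_mat (S * K) (S * L)
      (0\<^sub>m (n - r) r) (0\<^sub>m (n - r) (n - r))"
    unfolding J_def using K L S_carrier
    by (simp add: mult_four_block_mat[of _ r r _ 0 _ "n - r" _ _ r _ "n - r"])
  then have "A = U * (J * (S * W)) * adjoint U"
    by (simp add: form)
  then have A_eq: "A = P * S * Q"
    by (simp add: P_def Q_def mult_mat_assoc)
  have PP: "adjoint P * P = 1\<^sub>m r"
    by (simp add: P_def adjoint_mult mult_mat_assoc mult_mat_cancel_left[OF UU] JJ)
  have QQ: "Q * adjoint Q = 1\<^sub>m r"
    by (simp add: Q_def adjoint_mult mult_mat_assoc mult_mat_cancel_left[OF UU] WW)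
  have P_carrier: "P \<in> carrier_mat n r" and Q_carrier: "Q \<in> carrier_mat r n"
    by (auto simp: P_def Q_def)
  then have [simp]: "dim_row P = n" "dim_col P = r" "dim_row Q = r" "dim_col Q = n"
    by auto
  have QP: "Q * P = K"
    by (simp add: P_def Q_def mult_mat_assoc mult_mat_cancel_left[OF UU] WJ)

  have "\<exists>T\<in>carrier_mat r r. S * T = 1\<^sub>m r \<and> T * S = 1\<^sub>m r"
    unfolding S
    by (rule dreal_diag_inverse) (use \<mu> in \<open>auto simp: positive_appreciable_decreasing_def\<close>)
  then obtain T where T: "T \<in> carrier_mat r r" "S * T = 1\<^sub>m r" "T * S = 1\<^sub>m r"
    by blast
  obtain Y where Y: "Y \<in> carrier_mat n n" "A * A * Y = A"
    using dc_CM_factor[OF A] by blast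
  \<comment> \<open>Cancelling \<open>P * S\<close> on the left of \<open>A * A * Y = A\<close> and
    multiplying by \<open>adjoint Q\<close> on the right leaves
    \<open>Q * P * (S * Q * Y * adjoint Q)\<close> equal to the identity, which dictates this right
    inverse of \<open>K\<close>.\<close>
  define K' where "K' = S * Q * Y * adjoint Q"
  have [simp]: "dim_row T = r" "dim_col T = r" "dim_row Y = n" "dim_col Y = n"
    using T Y by auto
  have K': "K' \<in> carrier_mat r r"
    by (auto simp: K'_def)
  note cancel = mult_mat_assoc mult_mat_cancel_left[OF PP] mult_mat_cancel_left[OF T(3)]
  have "T * (adjoint P * (A * A * Y * adjoint Q)) = Q * P * K'"
    by (simp add: A_eq K'_def cancel)
  moreover have "T * (adjoint P * (A * adjoint Q)) = 1\<^sub>m r"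
    by (simp add: A_eq cancel QQ T)
  ultimately have KK': "Q * P * K' = 1\<^sub>m r"
    using Y(2) by simp
  have K'K: "K' * (Q * P) = 1\<^sub>m r"
    using KK' K K' unfolding QP by (rule mult_left_right_inverse_comm_ring[rotated 2])

  interpret F: orthonormal_factorization n r P S T Q K'
    by unfold_locales (fact P_carrier S_carrier T Q_carrier K' PP QQ KK' K'K)+
  have A_F: "F.A = A"
    by (simp add: F.A_def A_eq)
  note car = F.carriers[unfolded A_F]
  note MP = F.MP_props[unfolded A_F] and Group = F.Group_props[unfolded A_F]
    and Core = F.Core_props[unfolded A_F]
  have [simp]: "dim_row A = n"
    using car by auto

  obtain V where "is_dual_SVD n A U V r r \<mu>"
    using exists_dual_SVD[OF U Q_carrier QQ \<open>r \<le> n\<close> \<mu>, folded J_def S, folded P_def, folded A_eq]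
    by (elim exE)
  \<comment> \<open>\<open>F.MP\<close> serves as the inner inverse. The first equation of
    \<open>new_dual_MP_inverse\<close> thereby becomes the ordinary Moore-Penrose equation.\<close>
  then have ess: "essential_part A = A"
    using car MP(1) by (intro essential_part_regular)
  have "new_dual_MP_inverse A = F.MP"
    unfolding new_dual_MP_inverse_def ess
  proof (rule the_equality)
    show "X = F.MP" if "X \<in> carrier_mat (dim_row A) (dim_row A) \<and> A * X * A = A \<and> X * A * X = X
        \<and> adjoint (A * X) = A * X \<and> adjoint (X * A) = X * A" for X
      by (rule MP_inverse_unique[of A n]) (use that car MP in \<open>auto simp only: \<open>dim_row A = n\<close>\<close>)
  qed (use car MP in \<open>simp only: \<open>dim_row A = n\<close> simp_thms\<close>)
  moreover have "dual_group_inverse A = F.Group"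
    unfolding dual_group_inverse_def
  proof (rule the_equality)
    show "X = F.Group" if "X \<in> carrier_mat (dim_row A) (dim_row A) \<and> A * X * A = A
        \<and> X * A * X = X \<and> A * X = X * A" for X
      by (rule group_inverse_unique[of A n]) (use that car Group in \<open>auto simp only: \<open>dim_row A = n\<close>\<close>)
  qed (use car Group in \<open>simp only: \<open>dim_row A = n\<close> simp_thms\<close>)
  moreover have "dual_core_inverse A = F.Core"
    unfolding dual_core_inverse_def
  proof (rule the_equality)
    show "X = F.Core" if "X \<in> carrier_mat (dim_row A) (dim_row A) \<and> A * X * A = A
        \<and> A * (X * X) = X \<and> adjoint (A * X) = A * X" for X
      \<comment> \<open>\<open>F.Group\<close> is the commuting inner inverse that cancels
        \<open>A\<close>.\<close>
      by (rule core_inverse_unique[of A n _ _ F.Group])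
        (use that car Core Group in \<open>auto simp only: \<open>dim_row A = n\<close>\<close>)
  qed (use car Core in \<open>simp only: \<open>dim_row A = n\<close> simp_thms\<close>)
  moreover have "Q = Q * P * adjoint P \<longleftrightarrow> L = 0\<^sub>m r (n - r)"
  proof -
    have KJ: "K * adjoint J = four_block_mat K (0\<^sub>m r (n - r)) (0\<^sub>m 0 r) (0\<^sub>m 0 (n - r))"
      unfolding J_def using K
      by (subst adjoint_four_block_mat[of _ r r _ 0 _ "n - r"], (auto)[4],
          subst pad[symmetric, OF K],
          subst mult_four_block_mat[of _ r r _ 0 _ 0 _ _ r _ "n - r"]) auto
    \<comment> \<open>Right multiplication by the unitary \<open>U\<close> reduces the criterion to
      comparing \<open>[K L]\<close> with \<open>[K 0]\<close>.\<close>
    have "Q * P * adjoint P = K * adjoint J * adjoint U"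
      unfolding QP by (simp add: P_def adjoint_mult mult_mat_assoc)
    moreover have "Q * U = W" "K * adjoint J * adjoint U * U = K * adjoint J"
      by (simp_all add: Q_def mult_mat_assoc UU)
    ultimately have "Q = Q * P * adjoint P \<longleftrightarrow> W = K * adjoint J"
      by (metis Q_def)
    also have "\<dots> \<longleftrightarrow> L = 0\<^sub>m r (n - r)"
    proof
      assume eq: "W = K * adjoint J"
      show "L = 0\<^sub>m r (n - r)"
      proof (rule eq_matI)
        fix i j assume "i < dim_row (0\<^sub>m r (n - r) :: dcomplex mat)"
          "j < dim_col (0\<^sub>m r (n - r) :: dcomplex mat)"
        \<comment> \<open>The shift by \<open>r\<close> selects the second column block, which is
          \<open>L\<close> in \<open>W\<close> and zero in \<open>K * adjoint J\<close>.\<close>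
        then show "L $$ (i, j) = 0\<^sub>m r (n - r) $$ (i, j)"
          using arg_cong[OF eq, of "\<lambda>M. M $$ (i, j + r)"] by (simp add: W_def KJ)
      qed auto
    qed (simp add: W_def KJ)
    finally show ?thesis .
  qed
  ultimately show ?thesis
    using F.MP_eq_Group_iff F.MP_eq_Core_iff F.Group_eq_Core_iff by metis
qed

end
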